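(* Let $N\ge1$ be an integer. The invariant probability density $\rho_N$ of the transformation $T_N$ on $I=[0,1]$ is given by $$\rho_N(x)=\frac{k_N}{x+N},\quad x\in I,$$ where $k_N$ is the normalizing constant such that the invariant measure $G_N$, $G_N(A)=\int_A\rho_N(x)\,dx$ for $A\in\mathcal{B}_I$, is a probability measure. Furthermore, $$k_N=\left(\log\left(\frac{N+1}{N}\right)\right)^{-1}.$$
   Context: $\mathcal{B}_I$ is the $\sigma$-algebra of Borel subsets of $I=[0,1]$. $T_N:I\to I$ is defined by $T_N(x)=N/x-\lfloor N/x\rfloor$ for $x\ne0$ and $T_N(0)=0$. A measure $G_N$ on $(I,\mathcal{B}_I)$ is invariant under $T_N$ if $G_N(T_N^{-1}(A))=G_N(A)$ for any $A\in\mathcal{B}_I$; the density is taken with respect to Lebesgue measure. *)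

theory Defs
  imports "HOL-Probability.Probability"
begin

definition T :: "nat \<Rightarrow> real \<Rightarrow> real" where
  "T N x = (if x = 0 then 0 else real N / x - of_int \<lfloor>real N / x\<rfloor>)"

definition lebesgue_I :: "real measure" where
  "lebesgue_I = restrict_space lborel {0..1}"

lemma space_lebesgue_I: "space lebesgue_I = {0..1}"
  by (simp add: lebesgue_I_def)

lemma sets_lebesgue_I: "sets lebesgue_I = sets (restrict_space borel {0..1})"
  by (simp add: lebesgue_I_def sets_restrict_space)

text \<open>The preimage of a Borel set under \<open>T N\<close> is again Borel, so the use of
  \<^const>\<open>emeasure\<close> in the definition of invariance below never falls back on the
  default value for non-measurable sets.\<close>

lemma T_measurable: "T N \<in> measurable lebesgue_I lebesgue_I"
proof -
  have "T N \<in> borel_measurable borel"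
    unfolding T_def by measurable
  then have "T N \<in> borel_measurable lebesgue_I"
    unfolding lebesgue_I_def by (intro measurable_restrict_space1) simp
  moreover have "T N x \<in> {0..1}" for x
    unfolding T_def using floor_correct[of "real N / x"] by (simp, linarith)
  ultimately have "T N \<in> measurable lebesgue_I (restrict_space borel {0..1})"
    by (intro measurable_restrict_space2) auto
  then show ?thesis
    by (simp add: measurable_cong_sets[OF refl sets_lebesgue_I])
qed

definition invariant_measure :: "nat \<Rightarrow> real measure \<Rightarrow> bool" where
  "invariant_measure N M \<longleftrightarrow>
     sets M = sets (restrict_space borel {0..1}) \<and>
     (\<forall>A \<in> sets (restrict_space borel {0..1}).
        emeasure M (T N -` A \<inter> {0..1}) = emeasure M A)"

text \<open>Nonnegativity is required explicitly because \<^const>\<open>ennreal\<close> maps negative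
  reals to 0.\<close>

definition invariant_prob_density :: "nat \<Rightarrow> (real \<Rightarrow> real) \<Rightarrow> bool" where
  "invariant_prob_density N f \<longleftrightarrow>
     f \<in> borel_measurable lebesgue_I \<and>
     (\<forall>x \<in> {0..1}. 0 \<le> f x) \<and>
     prob_space (density lebesgue_I (\<lambda>x. ennreal (f x))) \<and>
     invariant_measure N (density lebesgue_I (\<lambda>x. ennreal (f x)))"

definition \<rho> :: "nat \<Rightarrow> real \<Rightarrow> real \<Rightarrow> real" where
  "\<rho> N k x = k / (x + real N)"

definition G :: "nat \<Rightarrow> real \<Rightarrow> real measure" where
  "G N k = density lebesgue_I (\<lambda>x. ennreal (\<rho> N k x))"

end

theory Submission imports Defs begin

text \<open>Invariance: summing \<open>k / (x + N)\<close> over the inverse branches \<open>y \<mapsto> N / (y + i)\<close>, \<open>i \<ge> N\<close>, with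
  their Jacobians gives the telescoping series \<open>\<Sum>i. k / (y + i) - k / (y + i + 1)\<close>.

  Uniqueness: the inverse branches of the iterates are Moebius maps whose derivatives have distortion
  bounded independently of the iterate, and their images (the cylinders) shrink to points. Hence an
  almost invariant set \<open>E\<close> of measure \<open>m\<close> occupies at least the proportion \<open>m / 2\<close> of every cylinder, so of every
  open set, so of open sets approximating its complement, which must therefore be null if
  \<open>m > 0\<close>. Given another invariant density \<open>f\<close>, the set where \<open>f\<close> exceeds the known density is
  almost invariant, hence null or conull, and the equality of the total masses forces equality
  almost everywhere.\<close>

section \<open>Inverse branches\<close>

lemma T_measurable_borel [measurable]: "T N \<in> borel_measurable borel"
  unfolding T_def by measurable

lemma T_range: "0 \<le> T N x" "T N x \<le> 1"
proof -
  show "0 \<le> T N x" unfolding T_def by simp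
  show "T N x \<le> 1" unfolding T_def using floor_correct[of "real N / x"] by (simp, linarith)
qed

lemma T_nonzero: "N \<ge> 1 \<Longrightarrow> x \<noteq> 0 \<Longrightarrow> x = real N / (T N x + real_of_int \<lfloor>real N / x\<rfloor>)"
  by (simp add: T_def)

text \<open>At \<open>y = 1\<close> the quotient \<open>y + i\<close> is the integer
  \<open>i + 1\<close> and \<open>T\<close> returns 0; this is why the integrals below discard the
  point 1.\<close>

lemma T_branch:
  assumes "0 \<le> y" "y < 1" "i \<ge> 1" "N \<ge> 1"
  shows "T N (real N / (y + real_of_int i)) = y"
proof -
  have "\<lfloor>y + real_of_int i\<rfloor> = i" using assms by linarith
  with assms show ?thesis by (simp add: T_def)
qed

text \<open>The digit condition \<open>i \<le> N / x < i + 1\<close> inverts to a half-open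
  interval. With \<open>i \<ge> N\<close> its right end \<open>N / i\<close> is at most 1, so
  \<open>x \<le> 1\<close> comes for free.\<close>

lemma floor_quotient_eq_iff:
  assumes "N \<ge> 1" "i \<ge> int N"
  shows "x \<in> {0..1} \<and> \<lfloor>real N / x\<rfloor> = i \<longleftrightarrow> x \<in> {real N / (real_of_int i + 1) <.. real N / real_of_int i}"
proof -
  have i: "real_of_int i \<ge> real N" "real_of_int i > 0" using assms by linarith+
  have "x \<in> {0..1} \<and> \<lfloor>real N / x\<rfloor> = i \<longleftrightarrow>
      x > 0 \<and> x \<le> 1 \<and> real_of_int i * x \<le> real N \<and> real N < (real_of_int i + 1) * x"
    using i by (cases "x = 0") (auto simp: floor_eq_iff field_simps)
  also have "\<dots> \<longleftrightarrow> x > 0 \<and> real_of_int i * x \<le> real N \<and> real N < (real_of_int i + 1) * x"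
  proof -
    have "x \<le> 1" if "x > 0" "real_of_int i * x \<le> real N"
    proof -
      have "real_of_int i * x \<le> real_of_int i * 1" using that i by linarith
      then show ?thesis using i by (simp only: mult_le_cancel_left_pos)
    qed
    then show ?thesis by blast
  qed
  also have "\<dots> \<longleftrightarrow> x \<in> {real N / (real_of_int i + 1) <.. real N / real_of_int i}"
  proof -
    have "real N / (real_of_int i + 1) > 0" using i assms by simp
    then have "x > 0" if "real N / (real_of_int i + 1) < x" using that by linarith
    moreover have "real N / (real_of_int i + 1) < x \<longleftrightarrow> real N < (real_of_int i + 1) * x"
      using i by (simp add: divide_less_eq mult.commute)
    moreover have "x \<le> real N / real_of_int i \<longleftrightarrow> real_of_int i * x \<le> real N"
      using i by (simp add: le_divide_eq mult.commute)
    ultimately show ?thesis by auto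
  qed
  finally show ?thesis .
qed

lemma nn_integral_branch:
  fixes h :: "real \<Rightarrow> ennreal"
  assumes "N \<ge> 1" "i \<ge> int N" and [measurable]: "h \<in> borel_measurable borel"
  shows "(\<integral>\<^sup>+x. h x * indicator {x\<in>{0..1}. \<lfloor>real N / x\<rfloor> = i} x \<partial>lborel) =
    (\<integral>\<^sup>+y. h (real N / (y + real_of_int i)) * ennreal (real N / (y + real_of_int i)\<^sup>2) *
      indicator {0..1} y \<partial>lborel)"
proof -
  define I where "I = real_of_int i"
  have I: "I \<ge> 1" using assms by (simp add: I_def)
  \<comment> \<open>The branch \<open>y \<mapsto> N / (y + i)\<close> decreases, whereas the
    substitution rule asks for a nonnegative derivative. \<open>?g\<close> is the branch precomposed
    with \<open>y \<mapsto> 1 - y\<close>; the affine substitution at the end undoes the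
    reflection.\<close>
  let ?g = "\<lambda>x. real N / (I + 1 - x)" and ?g' = "\<lambda>x. real N / (I + 1 - x)\<^sup>2"
  have "(\<integral>\<^sup>+x. h x * indicator {x\<in>{0..1}. \<lfloor>real N / x\<rfloor> = i} x \<partial>lborel) =
      (\<integral>\<^sup>+x. h x * indicator {?g 0..?g 1} x \<partial>lborel)"
  proof (intro nn_integral_cong_AE)
    \<comment> \<open>The digit set omits the left endpoint \<open>?g 0\<close>, a null set.\<close>
    show "AE x in lborel. h x * indicator {x\<in>{0..1}. \<lfloor>real N / x\<rfloor> = i} x =
        h x * indicator {?g 0..?g 1} x"
      using AE_lborel_singleton[of "?g 0"]
    proof eventually_elim
      case (elim x)
      have "x \<in> {x\<in>{0..1}. \<lfloor>real N / x\<rfloor> = i} \<longleftrightarrow> x \<in> {?g 0..?g 1}"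
        using floor_quotient_eq_iff[OF assms(1,2), of x] elim by (auto simp: I_def)
      then show ?case by (simp only: indicator_def)
    qed
  qed
  also have "\<dots> = (\<integral>\<^sup>+x. h (?g x) * ennreal (?g' x) * indicator {0..1} x \<partial>lborel)"
  proof (rule nn_integral_substitution_aux)
    show "(?g has_real_derivative ?g' x) (at x)" if "x \<in> {0..1}" for x
      using that I by (auto intro!: derivative_eq_intros simp: power2_eq_square)
    show "continuous_on {0..1} ?g'"
      using I by (intro continuous_intros) auto
  qed auto
  also have "\<dots> = (\<integral>\<^sup>+y. h (real N / (y + I)) * ennreal (real N / (y + I)\<^sup>2) *
      indicator {0..1} y \<partial>lborel)"
    by (subst nn_integral_real_affine[where c="-1" and t=1])
       (auto intro!: nn_integral_cong split: split_indicator simp: algebra_simps)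
  finally show ?thesis by (simp add: I_def)
qed

section \<open>Cylinders\<close>

text \<open>Partial quotients of the expansion \<open>N / (i1 + N / (i2 + ...))\<close>, on which
  \<open>T\<close> acts as the shift. Since \<open>N / 0 = 0\<close>, an orbit that reaches 0
  continues with digits 0, so every point has digits of every length.\<close>

fun digits :: "nat \<Rightarrow> nat \<Rightarrow> real \<Rightarrow> int list" where
  "digits N 0 x = []"
| "digits N (Suc n) x = \<lfloor>real N / x\<rfloor> # digits N n (T N x)"

text \<open>Words that no point realizes give the empty set, so the cylinders of all words of one
  length are disjoint and cover \<open>[0, 1]\<close> without any admissibility condition.\<close>

definition cylinder :: "nat \<Rightarrow> int list \<Rightarrow> real set" where
  "cylinder N w = {x\<in>{0..1}. digits N (length w) x = w}"

lemma length_digits [simp]: "length (digits N n x) = n"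
  by (induction n arbitrary: x) auto

text \<open>Makes cylinders nested. \<open>digits\<close> peels letters off the front while the
  letter dropped here is the last one, hence the induction.\<close>

lemma digits_Suc_eqD: "digits N (Suc n) x = digits N (Suc n) y \<Longrightarrow> digits N n x = digits N n y"
proof (induction n arbitrary: x y)
  case (Suc n)
  from Suc.prems have "\<lfloor>real N / x\<rfloor> = \<lfloor>real N / y\<rfloor>" "digits N (Suc n) (T N x) = digits N (Suc n) (T N y)"
    by (simp_all only: digits.simps list.inject)
  with Suc.IH[OF this(2)] show ?case by (simp only: digits.simps)
qed simp

lemma digits_measurable [measurable]: "Measurable.pred borel (\<lambda>x. digits N n x = w)"
proof (induction n arbitrary: w)
  case (Suc n)
  show ?case
  proof (cases w)
    case (Cons i v)
    note Suc[of v, measurable]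
    show ?thesis unfolding Cons digits.simps list.inject by measurable
  qed simp
qed simp

lemma cylinder_sets [measurable]: "cylinder N w \<in> sets borel"
  unfolding cylinder_def by measurable

text \<open>Prefixing \<open>i\<close> corresponds to applying an inverse branch to the cylinder, so
  induction on words becomes repeated change of variables.\<close>

lemma cylinder_Cons:
  "cylinder N (i # w) = {x\<in>{0..1}. \<lfloor>real N / x\<rfloor> = i \<and> T N x \<in> cylinder N w}"
  using T_range[of N] by (auto simp: cylinder_def)

text \<open>For \<open>0 < x \<le> 1\<close> the quotient \<open>N / x\<close> is at least
  \<open>N\<close>; smaller digits arise only from the convention \<open>N / 0 = 0\<close>.\<close>

lemma floor_quotient_small:
  assumes "N \<ge> 1" "x \<in> {0..1}" "\<lfloor>real N / x\<rfloor> < int N"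
  shows "x = 0"
proof (rule ccontr)
  assume "x \<noteq> 0"
  then have "real N / x \<ge> real N"
    using assms mult_left_le[of x "real N"] by (simp add: le_divide_eq)
  then show False using assms by linarith
qed

text \<open>The weight \<open>1 / (c x + d)\<^sup>2\<close> is, up to a constant, the derivative of a Moebius map;
  pulling it back along the branch \<open>y \<mapsto> N / (y + i)\<close> replaces \<open>(c, d)\<close> by
  \<open>(d, c N + d i)\<close>. Contraction is only visible for these weighted distances, since a single
  branch need not contract when \<open>N = 1\<close>.\<close>

lemma digits_contract:
  assumes "N \<ge> 1" "0 \<le> c" "c \<le> d" "0 < d" "x \<in> {0..1}" "y \<in> {0..1}"
    and "digits N n x = digits N n y"
  shows "\<bar>x - y\<bar> * (d * (c + d)) \<le> 2 / 2 ^ n * ((c * x + d) * (c * y + d))"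
  using assms
proof (induction n arbitrary: c d x y)
  case 0
  \<comment> \<open>The constant 2 is the distortion bound: \<open>c + d \<le> 2 * d\<close>, while
    both factors on the right are at least \<open>d\<close>.\<close>
  have "\<bar>x - y\<bar> * (d * (c + d)) \<le> 1 * (d * (d + d))"
    using 0 by (intro mult_mono) auto
  also have "\<dots> = 2 * (d * d)" by simp
  also have "\<dots> \<le> 2 * ((c * x + d) * (c * y + d))"
    using 0 by (intro mult_left_mono mult_mono) auto
  finally show ?case by simp
next
  case (Suc n)
  define i where "i = \<lfloor>real N / x\<rfloor>"
  have iy: "\<lfloor>real N / y\<rfloor> = i" using Suc.prems by (simp add: i_def)
  show ?case
  proof (cases "i < int N")
    case True
    then have "x = 0" "y = 0"
      using floor_quotient_small[of N x] floor_quotient_small[of N y] Suc.prems(1,5,6) iy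
      by (auto simp only: i_def)
    then show ?thesis by simp
  next
    case False
    then have i: "real_of_int i \<ge> real N" "real N \<ge> 1"
      using Suc.prems by linarith+
    have nz: "x \<noteq> 0" "y \<noteq> 0"
      using iy i by (auto simp: i_def)
    define u v where "u = T N x" and "v = T N y"
    have uv: "u \<in> {0..1}" "v \<in> {0..1}" using T_range by (auto simp: u_def v_def)
    have x: "x = real N / (u + i)" and y: "y = real N / (v + i)"
      using T_nonzero[OF Suc.prems(1) nz(1)] T_nonzero[OF Suc.prems(1) nz(2)] unfolding iy
      by (simp_all only: u_def v_def i_def)
    define d' where "d' = c * N + d * i"
    have "d * real N \<le> d * real_of_int i"
      using i Suc.prems by (intro mult_left_mono) auto
    then have d': "d' \<ge> N * (c + d)" by (simp add: d'_def algebra_simps)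
    have "c + d \<le> N * (c + d)" using i Suc.prems by (simp add: mult_le_cancel_right1)
    with d' have d'1: "d' \<ge> c + d" by linarith
    have IH: "\<bar>u - v\<bar> * (d' * (d + d')) \<le> 2 / 2 ^ n * ((d * u + d') * (d * v + d'))"
      using Suc.prems d'1 uv by (intro Suc.IH) (auto simp: u_def v_def)
    have pos: "u + i > 0" "v + i > 0" using uv i by auto
    \<comment> \<open>The factor 1/2 per digit arises here, from \<open>d' \<ge> N * (c + d)\<close>
      and \<open>d' \<ge> d\<close>.\<close>
    have "2 * (N * d * (c + d)) = (N * (c + d)) * (d + d)" by simp
    also have "\<dots> \<le> d' * (d + d')"
      using d' d'1 Suc.prems by (intro mult_mono) auto
    finally have "\<bar>u - v\<bar> * (2 * (N * d * (c + d))) \<le> \<bar>u - v\<bar> * (d' * (d + d'))"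
      by (intro mult_left_mono) auto
    with IH have *: "\<bar>u - v\<bar> * (N * d * (c + d)) \<le> 1 / 2 ^ n * ((d * u + d') * (d * v + d'))"
      by simp
    have "\<bar>x - y\<bar> = \<bar>u - v\<bar> * N / ((u + i) * (v + i))"
    proof -
      have "x - y = (v - u) * N / ((u + i) * (v + i))"
        using pos unfolding x y by (simp add: field_simps)
      then show ?thesis using pos by (simp add: abs_mult abs_minus_commute)
    qed
    then have "\<bar>x - y\<bar> * (d * (c + d)) = \<bar>u - v\<bar> * (N * d * (c + d)) / ((u + i) * (v + i))"
      by simp
    also have "\<dots> \<le> 1 / 2 ^ n * ((d * u + d') * (d * v + d')) / ((u + i) * (v + i))"
      using * pos by (intro divide_right_mono) auto
    also have "\<dots> = 1 / 2 ^ n * (((d * u + d') / (u + i)) * ((d * v + d') / (v + i)))"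
      by simp
    \<comment> \<open>The weights transform exactly, so the denominators from \<open>x - y\<close>
      are absorbed without loss.\<close>
    also have "(d * u + d') / (u + i) = c * x + d"
      using pos unfolding x d'_def by (simp add: field_simps)
    also have "(d * v + d') / (v + i) = c * y + d"
      using pos unfolding y d'_def by (simp add: field_simps)
    finally show ?thesis by simp
  qed
qed

text \<open>For \<open>c = 0\<close> and \<open>d = 1\<close> the weight is constant and the
  weighted distance is the ordinary one.\<close>

lemma digits_dist:
  assumes "N \<ge> 1" "x \<in> {0..1}" "y \<in> {0..1}" "digits N n x = digits N n y"
  shows "\<bar>x - y\<bar> \<le> 2 / 2 ^ n"
  using digits_contract[of N 0 1 x y n] assms by simp


section \<open>Ergodicity\<close>

text \<open>At \<open>x = N / (y + i)\<close> the term \<open>c * x + d\<close> equals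
  \<open>(d * y + c * N + d * i) / (y + i)\<close>, whose denominator cancels against the Jacobian
  \<open>N / (y + i)\<^sup>2\<close>. A weight of the same form and the constant \<open>N\<close>
  remain.\<close>

lemma nn_integral_weight_branch:
  assumes "N \<ge> 1" "i \<ge> int N" "0 \<le> c" "c \<le> d" "0 < d" and [measurable]: "A \<in> sets borel"
  shows "(\<integral>\<^sup>+x. ennreal (1 / (c * x + d)\<^sup>2) *
      indicator {x\<in>{0..1}. \<lfloor>real N / x\<rfloor> = i \<and> T N x \<in> A} x \<partial>lborel) =
    ennreal (real N) * (\<integral>\<^sup>+y. ennreal (1 / (d * y + (c * real N + d * real_of_int i))\<^sup>2) *
      indicator (A \<inter> {0..1}) y \<partial>lborel)"
proof -
  define h where "h x = ennreal (1 / (c * x + d)\<^sup>2) * indicator A (T N x)" for x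
  have [measurable]: "h \<in> borel_measurable borel" unfolding h_def by measurable
  have i: "real_of_int i \<ge> 1" "i \<ge> 1" using assms by linarith+
  have "(\<integral>\<^sup>+x. ennreal (1 / (c * x + d)\<^sup>2) *
      indicator {x\<in>{0..1}. \<lfloor>real N / x\<rfloor> = i \<and> T N x \<in> A} x \<partial>lborel) =
      (\<integral>\<^sup>+x. h x * indicator {x\<in>{0..1}. \<lfloor>real N / x\<rfloor> = i} x \<partial>lborel)"
    by (intro nn_integral_cong) (auto simp: h_def split: split_indicator)
  also have "\<dots> = (\<integral>\<^sup>+y. h (real N / (y + real_of_int i)) * ennreal (real N / (y + real_of_int i)\<^sup>2) *
      indicator {0..1} y \<partial>lborel)"
    using assms by (intro nn_integral_branch) auto
  also have "\<dots> = (\<integral>\<^sup>+y. ennreal (real N) * (ennreal (1 / (d * y + (c * real N + d * real_of_int i))\<^sup>2) *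
      indicator (A \<inter> {0..1}) y) \<partial>lborel)"
  proof (intro nn_integral_cong_AE)
    show "AE y in lborel. h (real N / (y + real_of_int i)) * ennreal (real N / (y + real_of_int i)\<^sup>2) *
      indicator {0..1} y = ennreal (real N) *
      (ennreal (1 / (d * y + (c * real N + d * real_of_int i))\<^sup>2) * indicator (A \<inter> {0..1}) y)"
      using AE_lborel_singleton[of 1]
    proof eventually_elim
      case (elim y)
      show ?case
      proof (cases "y \<in> {0..1}")
        case True
        then have y: "0 \<le> y" "y < 1" using elim by auto
        have pos: "y + real_of_int i > 0" using y i by linarith
        have "c * (real N / (y + real_of_int i)) + d =
            (d * y + (c * real N + d * real_of_int i)) / (y + real_of_int i)"
          using pos by (simp add: field_simps)
        then have "1 / (c * (real N / (y + real_of_int i)) + d)\<^sup>2 * (real N / (y + real_of_int i)\<^sup>2) =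
            real N * (1 / (d * y + (c * real N + d * real_of_int i))\<^sup>2)"
          using pos by (simp add: power_divide)
        then have "ennreal (1 / (c * (real N / (y + real_of_int i)) + d)\<^sup>2) *
            ennreal (real N / (y + real_of_int i)\<^sup>2) =
            ennreal (real N) * ennreal (1 / (d * y + (c * real N + d * real_of_int i))\<^sup>2)"
          by (simp only: ennreal_mult'[symmetric] zero_le_divide_1_iff zero_le_power2 of_nat_0_le_iff
              divide_nonneg_nonneg)
        moreover have "T N (real N / (y + real_of_int i)) = y"
          using y i assms by (intro T_branch) auto
        ultimately show ?thesis
          using True by (simp add: h_def indicator_def)
      qed simp
    qed
  qed
  also have "\<dots> = ennreal (real N) * (\<integral>\<^sup>+y. ennreal (1 / (d * y + (c * real N + d * real_of_int i))\<^sup>2) *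
      indicator (A \<inter> {0..1}) y \<partial>lborel)"
    by (intro nn_integral_cmult) measurable
  finally show ?thesis .
qed

text \<open>The antiderivative \<open>x / (d * (c * x + d))\<close> vanishes at 0 and, unlike
  \<open>-1 / (c * (c * x + d))\<close>, also covers \<open>c = 0\<close>.\<close>

lemma nn_integral_weight:
  fixes c d :: real
  assumes "0 \<le> c" "0 < d"
  shows "(\<integral>\<^sup>+x. ennreal (1 / (c * x + d)\<^sup>2) * indicator {0..1} x \<partial>lborel) = ennreal (1 / (d * (c + d)))"
proof -
  have pos: "c * x + d > 0" if "0 \<le> x" for x
    using assms that by (intro add_nonneg_pos mult_nonneg_nonneg)
  have "(\<integral>\<^sup>+x. ennreal (1 / (c * x + d)\<^sup>2) * indicator {0..1} x \<partial>lborel) =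
      ennreal (1 / (d * (c * 1 + d)) - 0 / (d * (c * 0 + d)))"
  proof (rule nn_integral_FTC_Icc[where F = "\<lambda>x. x / (d * (c * x + d))"])
    show "((\<lambda>x. x / (d * (c * x + d))) has_real_derivative 1 / (c * x + d)\<^sup>2) (at x)"
      if x: "x \<in> {0..1}" for x
    proof -
      have "((\<lambda>x. x / (d * (c * x + d))) has_real_derivative
          (1 * (d * (c * x + d)) - x * (d * c)) / (d * (c * x + d))\<^sup>2) (at x)"
        using pos[of x] x assms by (auto intro!: derivative_eq_intros simp: power2_eq_square)
      moreover have "1 * (d * (c * x + d)) - x * (d * c) = d\<^sup>2"
        by (simp add: algebra_simps power2_eq_square)
      ultimately show ?thesis
        using assms by (simp add: power_mult_distrib)
    qed
  qed (use assms in auto)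
  then show ?thesis by simp
qed

text \<open>Knopp's argument: a weight with \<open>c \<le> d\<close> is at least half its mean on \<open>[0, 1]\<close>, so an invariant
  set fills at least half of its share of every cylinder.\<close>

lemma cylinder_invariant_weight:
  assumes "N \<ge> 1" and [measurable]: "E \<in> sets borel"
    and inv: "AE x in lborel. x \<in> {0..1} \<longrightarrow> (x \<in> E \<longleftrightarrow> T N x \<in> E)"
    and "0 \<le> c" "c \<le> d" "0 < d"
  shows "emeasure lborel (E \<inter> {0..1}) *
      (\<integral>\<^sup>+x. ennreal (1 / (c * x + d)\<^sup>2) * indicator (cylinder N w) x \<partial>lborel) \<le>
    2 * (\<integral>\<^sup>+x. ennreal (1 / (c * x + d)\<^sup>2) * indicator (cylinder N w \<inter> E) x \<partial>lborel)"
  using assms(4-)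
proof (induction w arbitrary: c d)
  case Nil
  have cyl: "cylinder N [] = {0..1}" by (auto simp: cylinder_def)
  \<comment> \<open>The weight has integral \<open>1 / (d * (c + d))\<close> over
    \<open>[0, 1]\<close> and its least value there, taken at 1, is
    \<open>1 / (c + d)\<^sup>2\<close>. Since \<open>c \<le> d\<close>, the former is at most twice
    the latter.\<close>
  have "emeasure lborel (E \<inter> {0..1}) * ennreal (1 / (d * (c + d))) \<le>
      emeasure lborel (E \<inter> {0..1}) * (2 * ennreal (1 / (c + d)\<^sup>2))"
  proof (intro mult_left_mono)
    have "1 / (d * (c + d)) = 2 / (2 * d * (c + d))" by simp
    also have "\<dots> \<le> 2 / ((c + d) * (c + d))"
      using Nil by (intro divide_left_mono mult_right_mono mult_pos_pos) auto
    finally have "1 / (d * (c + d)) \<le> 2 * (1 / (c + d)\<^sup>2)" by (simp add: power2_eq_square)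
    then show "ennreal (1 / (d * (c + d))) \<le> 2 * ennreal (1 / (c + d)\<^sup>2)"
      by (metis ennreal_leI ennreal_mult' ennreal_numeral zero_le_numeral)
  qed simp
  also have "\<dots> = 2 * (\<integral>\<^sup>+x. ennreal (1 / (c + d)\<^sup>2) * indicator ({0..1} \<inter> E) x \<partial>lborel)"
    by (subst nn_integral_cmult_indicator) (simp_all add: ac_simps Int_commute)
  also have "\<dots> \<le> 2 * (\<integral>\<^sup>+x. ennreal (1 / (c * x + d)\<^sup>2) * indicator ({0..1} \<inter> E) x \<partial>lborel)"
  proof (intro mult_left_mono nn_integral_mono)
    fix x :: real
    show "ennreal (1 / (c + d)\<^sup>2) * indicator ({0..1} \<inter> E) x \<le>
        ennreal (1 / (c * x + d)\<^sup>2) * indicator ({0..1} \<inter> E) x"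
    proof (cases "x \<in> {0..1}")
      case True
      then have "0 < c * x + d" "c * x + d \<le> c + d"
        using Nil by (auto intro: add_nonneg_pos simp: mult_left_le)
      then have "1 / (c + d)\<^sup>2 \<le> 1 / (c * x + d)\<^sup>2"
        by (intro divide_left_mono power_mono) auto
      then show ?thesis by (intro mult_right_mono ennreal_leI) auto
    qed (auto simp: indicator_def)
  qed simp
  finally show ?case using Nil by (simp add: cyl nn_integral_weight)
next
  case (Cons i w)
  show ?case
  proof (cases "i < int N")
    case True
    have sub: "cylinder N (i # w) \<subseteq> {0}"
    proof
      fix x assume "x \<in> cylinder N (i # w)"
      then have "x \<in> {0..1}" "\<lfloor>real N / x\<rfloor> = i" by (simp_all only: cylinder_Cons mem_Collect_eq)
      then show "x \<in> {0}" using floor_quotient_small[OF assms(1)] True by simp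
    qed
    have "(\<integral>\<^sup>+x. ennreal (1 / (c * x + d)\<^sup>2) * indicator (cylinder N (i # w)) x \<partial>lborel) = 0"
    proof (subst nn_integral_0_iff_AE)
      show "AE x in lborel. ennreal (1 / (c * x + d)\<^sup>2) * indicator (cylinder N (i # w)) x = 0"
        using AE_lborel_singleton[of 0] by eventually_elim (use sub in \<open>auto split: split_indicator\<close>)
    qed measurable
    then show ?thesis by simp
  next
    case False
    define d' where "d' = c * real N + d * real_of_int i"
    have i: "i \<ge> int N" "real_of_int i \<ge> 1" using False assms(1) by linarith+
    \<comment> \<open>The bound \<open>d \<le> d'\<close> lets the induction hypothesis apply to the
      pair \<open>(d, d')\<close>.\<close>
    have "d * 1 \<le> d * real_of_int i" using i Cons.prems by (intro mult_left_mono) auto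
    moreover have "c * real N \<ge> 0" using Cons.prems by simp
    ultimately have d': "d \<le> d'" by (simp add: d'_def)
    note branch = nn_integral_weight_branch[OF assms(1) i(1) Cons.prems, folded d'_def]
    have sub: "cylinder N w \<inter> {0..1} = cylinder N w" by (auto simp: cylinder_def)
    have "emeasure lborel (E \<inter> {0..1}) *
        (\<integral>\<^sup>+x. ennreal (1 / (c * x + d)\<^sup>2) * indicator (cylinder N (i # w)) x \<partial>lborel) =
        ennreal (real N) * (emeasure lborel (E \<inter> {0..1}) *
        (\<integral>\<^sup>+y. ennreal (1 / (d * y + d')\<^sup>2) * indicator (cylinder N w) y \<partial>lborel))"
      unfolding cylinder_Cons by (subst branch) (simp_all add: sub mult.left_commute)
    also have "\<dots> \<le> ennreal (real N) * (2 *
        (\<integral>\<^sup>+y. ennreal (1 / (d * y + d')\<^sup>2) * indicator (cylinder N w \<inter> E) y \<partial>lborel))"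
      using Cons.prems d' by (intro mult_left_mono Cons.IH) auto
    also have "\<dots> = 2 * (\<integral>\<^sup>+x. ennreal (1 / (c * x + d)\<^sup>2) *
        indicator {x\<in>{0..1}. \<lfloor>real N / x\<rfloor> = i \<and> T N x \<in> cylinder N w \<inter> E} x \<partial>lborel)"
    proof (subst branch)
      have "cylinder N w \<inter> E \<inter> {0..1} = cylinder N w \<inter> E" using sub by auto
      then show "ennreal (real N) * (2 *
          (\<integral>\<^sup>+y. ennreal (1 / (d * y + d')\<^sup>2) * indicator (cylinder N w \<inter> E) y \<partial>lborel)) =
          2 * (ennreal (real N) *
          (\<integral>\<^sup>+y. ennreal (1 / (d * y + d')\<^sup>2) * indicator (cylinder N w \<inter> E \<inter> {0..1}) y \<partial>lborel))"
        by (simp add: ac_simps)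
    qed measurable
    \<comment> \<open>Here invariance enters: \<open>T N x \<in> E\<close> is traded for
      \<open>x \<in> E\<close> outside a null set.\<close>
    also have "(\<integral>\<^sup>+x. ennreal (1 / (c * x + d)\<^sup>2) *
        indicator {x\<in>{0..1}. \<lfloor>real N / x\<rfloor> = i \<and> T N x \<in> cylinder N w \<inter> E} x \<partial>lborel) =
        (\<integral>\<^sup>+x. ennreal (1 / (c * x + d)\<^sup>2) * indicator (cylinder N (i # w) \<inter> E) x \<partial>lborel)"
      using inv by (intro nn_integral_cong_AE, eventually_elim)
        (auto simp: cylinder_Cons split: split_indicator)
    finally show ?thesis .
  qed
qed

text \<open>\<open>U \<inter> {0..1}\<close> is the increasing union of the sets \<open>V n\<close>,
  each made of the cylinders of length \<open>n\<close> inside \<open>U\<close>, because cylinders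
  shrink. The constant weight (\<open>c = 0\<close>, \<open>d = 1\<close>) gives the bound on each
  cylinder; it is summed over the countably many words and passed to the limit.\<close>

lemma open_invariant_measure:
  assumes "N \<ge> 1" and [measurable]: "E \<in> sets borel"
    and inv: "AE x in lborel. x \<in> {0..1} \<longrightarrow> (x \<in> E \<longleftrightarrow> T N x \<in> E)"
    and "open U"
  shows "emeasure lborel (E \<inter> {0..1}) * emeasure lborel (U \<inter> {0..1}) \<le>
    2 * emeasure lborel (U \<inter> {0..1} \<inter> E)"
proof -
  have cyl: "emeasure lborel (E \<inter> {0..1}) * emeasure lborel (cylinder N w) \<le>
      2 * emeasure lborel (cylinder N w \<inter> E)" for w
    using cylinder_invariant_weight[OF assms(1-3), of 0 1 w] by simp
  define W where "W n = {w. length w = n \<and> cylinder N w \<subseteq> U}" for n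
  define V where "V n = (\<Union>w\<in>W n. cylinder N w)" for n
  have countable_W: "countable (W n)" for n by auto
  have V_sets [measurable]: "V n \<in> sets borel" for n
    unfolding V_def using countable_W by (intro sets.countable_UN') auto
  have disj: "disjoint_family_on (\<lambda>w. cylinder N w \<inter> A) (W n)" for n A
    by (auto simp: disjoint_family_on_def cylinder_def W_def)
  have V: "emeasure lborel (E \<inter> {0..1}) * emeasure lborel (V n) \<le> 2 * emeasure lborel (V n \<inter> E)" for n
  proof -
    have "emeasure lborel (V n) = (\<integral>\<^sup>+w. emeasure lborel (cylinder N w) \<partial>count_space (W n))"
      unfolding V_def using disj[of UNIV] countable_W by (intro emeasure_UN_countable) auto
    then have "emeasure lborel (E \<inter> {0..1}) * emeasure lborel (V n) =
        (\<integral>\<^sup>+w. emeasure lborel (E \<inter> {0..1}) * emeasure lborel (cylinder N w) \<partial>count_space (W n))"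
      by (simp add: nn_integral_cmult)
    also have "\<dots> \<le> (\<integral>\<^sup>+w. 2 * emeasure lborel (cylinder N w \<inter> E) \<partial>count_space (W n))"
      by (intro nn_integral_mono cyl)
    also have "\<dots> = 2 * (\<integral>\<^sup>+w. emeasure lborel (cylinder N w \<inter> E) \<partial>count_space (W n))"
      by (simp add: nn_integral_cmult)
    also have "(\<integral>\<^sup>+w. emeasure lborel (cylinder N w \<inter> E) \<partial>count_space (W n)) =
        emeasure lborel (\<Union>w\<in>W n. cylinder N w \<inter> E)"
      using disj[of E] countable_W by (intro emeasure_UN_countable[symmetric]) auto
    also have "(\<Union>w\<in>W n. cylinder N w \<inter> E) = V n \<inter> E" by (auto simp: V_def)
    finally show ?thesis .
  qed
  have V_iff: "x \<in> V n \<longleftrightarrow> x \<in> {0..1} \<and> cylinder N (digits N n x) \<subseteq> U" for x n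
    by (auto simp: V_def W_def cylinder_def)
  have "incseq V"
  proof (intro incseq_SucI subsetI)
    fix n x assume x: "x \<in> V n"
    have "cylinder N (digits N (Suc n) x) \<subseteq> cylinder N (digits N n x)"
    proof
      fix y assume "y \<in> cylinder N (digits N (Suc n) x)"
      then have "y \<in> {0..1}" "digits N (Suc n) y = digits N (Suc n) x"
        by (simp_all only: cylinder_def mem_Collect_eq length_digits)
      with digits_Suc_eqD[OF this(2)] show "y \<in> cylinder N (digits N n x)"
        by (simp only: cylinder_def mem_Collect_eq length_digits)
    qed
    with x show "x \<in> V (Suc n)" unfolding V_iff by blast
  qed
  have UN: "(\<Union>n. V n) = U \<inter> {0..1}"
  proof (intro equalityI subsetI)
    fix x assume "x \<in> (\<Union>n. V n)"
    then show "x \<in> U \<inter> {0..1}" by (auto simp: V_iff cylinder_def)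
  next
    fix x assume x: "x \<in> U \<inter> {0..1}"
    then obtain e where e: "e > 0" "\<And>y. dist y x < e \<Longrightarrow> y \<in> U"
      using \<open>open U\<close> x unfolding open_dist by (metis IntD1)
    obtain n where "(1/2::real) ^ n < e / 2"
      using real_arch_pow_inv[of "e/2" "1/2"] e by auto
    then have n: "2 / 2 ^ n < e" by (simp add: field_simps)
    have "cylinder N (digits N n x) \<subseteq> U"
    proof
      fix y assume "y \<in> cylinder N (digits N n x)"
      then have "\<bar>y - x\<bar> \<le> 2 / 2 ^ n"
        using x assms(1) by (intro digits_dist) (auto simp: cylinder_def)
      then show "y \<in> U" using n e by (auto simp: dist_real_def)
    qed
    then show "x \<in> (\<Union>n. V n)" using x by (auto simp: V_iff)
  qed
  have "emeasure lborel (U \<inter> {0..1}) = (SUP n. emeasure lborel (V n))"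
    unfolding UN[symmetric] using \<open>incseq V\<close> by (intro SUP_emeasure_incseq[symmetric]) auto
  then have "emeasure lborel (E \<inter> {0..1}) * emeasure lborel (U \<inter> {0..1}) =
      (SUP n. emeasure lborel (E \<inter> {0..1}) * emeasure lborel (V n))"
    by (simp add: SUP_mult_left_ennreal)
  also have "\<dots> \<le> 2 * emeasure lborel (U \<inter> {0..1} \<inter> E)"
  proof (intro SUP_least)
    fix n
    have [measurable]: "U \<in> sets borel" using \<open>open U\<close> by simp
    have "V n \<inter> E \<subseteq> U \<inter> {0..1} \<inter> E" using UN by auto
    then have "emeasure lborel (V n \<inter> E) \<le> emeasure lborel (U \<inter> {0..1} \<inter> E)"
      by (intro emeasure_mono) measurable
    then show "emeasure lborel (E \<inter> {0..1}) * emeasure lborel (V n) \<le>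
        2 * emeasure lborel (U \<inter> {0..1} \<inter> E)"
      using V[of n] by (meson mult_left_mono order_trans zero_le)
  qed
  finally show ?thesis .
qed

text \<open>If an open \<open>U\<close> exceeds the complement of \<open>E\<close> by measure less
  than \<open>e / 2\<close>, then \<open>U \<inter> {0..1} \<inter> E\<close> lies in the excess,
  and the previous bound makes the product of the measures of \<open>E\<close> and its complement at
  most \<open>e\<close>.\<close>

theorem T_ergodic:
  assumes "N \<ge> 1" and [measurable]: "E \<in> sets borel"
    and inv: "AE x in lborel. x \<in> {0..1} \<longrightarrow> (x \<in> E \<longleftrightarrow> T N x \<in> E)"
  shows "emeasure lborel (E \<inter> {0..1}) = 0 \<or> emeasure lborel ({0..1} - E) = 0"
proof -
  let ?m = "emeasure lborel (E \<inter> {0..1}) * emeasure lborel ({0..1} - E)"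
  have "?m \<le> 0"
  proof (rule ennreal_le_epsilon)
    fix e :: real assume "e > 0"
    then obtain U where U: "open U" "{0..1} - E \<subseteq> U" "emeasure lborel (U - ({0..1} - E)) < e / 2"
      using outer_regular_lborel[of "{0..1} - E" "e / 2"] by auto
    have [measurable]: "U \<in> sets borel" using \<open>open U\<close> by simp
    have "?m \<le> emeasure lborel (E \<inter> {0..1}) * emeasure lborel (U \<inter> {0..1})"
      using U by (intro mult_left_mono emeasure_mono) auto
    also have "\<dots> \<le> 2 * emeasure lborel (U \<inter> {0..1} \<inter> E)"
      using assms U by (intro open_invariant_measure)
    also have "\<dots> \<le> 2 * emeasure lborel (U - ({0..1} - E))"
      by (intro mult_left_mono emeasure_mono) auto
    also have "\<dots> \<le> 2 * ennreal (e / 2)"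
      using U by (intro mult_left_mono) auto
    also have "\<dots> = ennreal e"
      using \<open>e > 0\<close> by (simp add: ennreal_mult'[symmetric] flip: ennreal_numeral)
    finally show "?m \<le> 0 + ennreal e" by simp
  qed
  then show ?thesis by simp
qed


section \<open>The invariant density\<close>

lemma nn_integral_lebesgue_I: "(\<integral>\<^sup>+x. f x \<partial>lebesgue_I) = (\<integral>\<^sup>+x. f x * indicator {0..1} x \<partial>lborel)"
  by (simp add: lebesgue_I_def nn_integral_restrict_space)

lemma AE_lebesgue_I_iff: "(AE x in lebesgue_I. P x) \<longleftrightarrow> (AE x in lborel. x \<in> {0..1} \<longrightarrow> P x)"
  unfolding lebesgue_I_def by (subst AE_restrict_space_iff) simp_all

lemma sets_lebesgue_I_iff: "A \<in> sets lebesgue_I \<longleftrightarrow> A \<in> sets borel \<and> A \<subseteq> {0..1}"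
  by (auto simp: sets_lebesgue_I sets_restrict_space_iff)

lemma \<rho>_measurable [measurable]: "\<rho> N k \<in> borel_measurable borel"
  unfolding \<rho>_def by measurable

lemma \<rho>_measurable_lebesgue_I [measurable]: "\<rho> N k \<in> borel_measurable lebesgue_I"
  unfolding lebesgue_I_def by (intro measurable_restrict_space1) simp

lemma emeasure_G:
  assumes "A \<in> sets borel" "A \<subseteq> {0..1}"
  shows "emeasure (G N k) A = (\<integral>\<^sup>+x. ennreal (\<rho> N k x) * indicator A x \<partial>lborel)"
proof -
  have "A \<in> sets lebesgue_I" using assms by (simp add: sets_lebesgue_I_iff)
  then have "emeasure (G N k) A =
      (\<integral>\<^sup>+x. ennreal (\<rho> N k x) * indicator A x * indicator {0..1} x \<partial>lborel)"
    unfolding G_def by (simp add: emeasure_density nn_integral_lebesgue_I)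
  also have "\<dots> = (\<integral>\<^sup>+x. ennreal (\<rho> N k x) * indicator A x \<partial>lborel)"
    using assms by (intro nn_integral_cong) (auto split: split_indicator)
  finally show ?thesis .
qed

lemma emeasure_G_space:
  assumes "N \<ge> 1" "k \<ge> 0"
  shows "emeasure (G N k) {0..1} = ennreal (k * ln ((real N + 1) / real N))"
proof -
  have "(\<integral>\<^sup>+x. ennreal (\<rho> N k x) * indicator {0..1} x \<partial>lborel) =
      ennreal (k * ln (1 + real N) - k * ln (0 + real N))"
  proof (rule nn_integral_FTC_Icc[where F = "\<lambda>x. k * ln (x + real N)"])
    show "((\<lambda>x. k * ln (x + real N)) has_real_derivative \<rho> N k x) (at x)" if "x \<in> {0..1}" for x
      using that assms by (auto intro!: derivative_eq_intros simp: \<rho>_def)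
  qed (use assms in \<open>auto simp: \<rho>_def\<close>)
  also have "k * ln (1 + real N) - k * ln (0 + real N) = k * ln ((real N + 1) / real N)"
    using assms by (simp add: ln_div algebra_simps)
  finally show ?thesis by (simp add: emeasure_G)
qed

lemma prob_space_G_iff:
  assumes "N \<ge> 1"
  shows "prob_space (G N k) \<longleftrightarrow> k = inverse (ln ((real N + 1) / real N))"
proof -
  have ln: "ln ((real N + 1) / real N) > 0" using assms by simp
  have iff: "prob_space (G N k) \<longleftrightarrow> emeasure (G N k) {0..1} = 1"
  proof -
    have "space (G N k) = {0..1}" by (simp add: G_def space_lebesgue_I)
    then show ?thesis
      using prob_space.emeasure_space_1[of "G N k"] prob_spaceI[of "G N k"] by auto
  qed
  show ?thesis
  proof (cases "k \<ge> 0")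
    case True
    then show ?thesis
      unfolding iff emeasure_G_space[OF assms True] ennreal_eq_1 using ln by (simp add: field_simps)
  next
    \<comment> \<open>For \<open>k < 0\<close> the function \<open>\<rho> N k\<close> is negative
      and \<open>ennreal\<close> truncates it to 0, so \<open>G N k\<close> is the zero
      measure.\<close>
    case False
    have "(\<integral>\<^sup>+x. ennreal (\<rho> N k x) * indicator {0..1} x \<partial>lborel) = (\<integral>\<^sup>+x. 0 \<partial>(lborel :: real measure))"
      using False assms
      by (intro nn_integral_cong) (auto simp: \<rho>_def ennreal_neg divide_le_0_iff split: split_indicator)
    then have "\<not> prob_space (G N k)" unfolding iff by (simp add: emeasure_G)
    moreover have "inverse (ln ((real N + 1) / real N)) > 0" using ln by simp
    ultimately show ?thesis using False by auto
  qed
qed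

text \<open>The sets with first digit \<open>N + j\<close> partition \<open>(0, 1]\<close>, and each
  is handled by its own change of variables. The inner sum is the transfer operator of
  \<open>T\<close> applied to \<open>h\<close>.\<close>

lemma nn_integral_sum_branches:
  fixes h :: "real \<Rightarrow> ennreal"
  assumes "N \<ge> 1" and [measurable]: "h \<in> borel_measurable borel"
  shows "(\<integral>\<^sup>+x. h x * indicator {0..1} x \<partial>lborel) =
    (\<integral>\<^sup>+y. (\<Sum>j. h (real N / (y + real (N + j))) * ennreal (real N / (y + real (N + j))\<^sup>2)) *
      indicator {0..1} y \<partial>lborel)"
proof -
  define B where "B j = {x\<in>{0..1}. \<lfloor>real N / x\<rfloor> = int (N + j)}" for j
  have [measurable]: "B j \<in> sets borel" for j unfolding B_def by measurable
  have "(\<integral>\<^sup>+x. h x * indicator {0..1} x \<partial>lborel) = (\<integral>\<^sup>+x. (\<Sum>j. h x * indicator (B j) x) \<partial>lborel)"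
  proof (intro nn_integral_cong_AE)
    show "AE x in lborel. h x * indicator {0..1} x = (\<Sum>j. h x * indicator (B j) x)"
      using AE_lborel_singleton[of 0]
    proof eventually_elim
      case (elim x)
      show ?case
      proof (cases "x \<in> {0..1}")
        case True
        then have "\<not> \<lfloor>real N / x\<rfloor> < int N"
          using floor_quotient_small[OF assms(1) True] elim by auto
        then have "x \<in> B (nat (\<lfloor>real N / x\<rfloor> - int N))" using True by (simp add: B_def)
        moreover have "disjoint_family B" by (auto simp: disjoint_family_on_def B_def)
        ultimately show ?thesis
          using True suminf_cmult_indicator[of B x _ "\<lambda>_. h x"] by simp
      next
        case False
        then have "indicator (B j) x = (0 :: ennreal)" for j by (auto simp: B_def)
        with False show ?thesis by simp
      qed
    qed
  qed
  also have "\<dots> = (\<Sum>j. \<integral>\<^sup>+x. h x * indicator (B j) x \<partial>lborel)"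
    by (intro nn_integral_suminf) measurable
  also have "\<dots> = (\<Sum>j. \<integral>\<^sup>+y. h (real N / (y + real (N + j))) * ennreal (real N / (y + real (N + j))\<^sup>2) *
      indicator {0..1} y \<partial>lborel)"
    using nn_integral_branch[OF assms(1) _ assms(2), of "int (N + _)"]
    unfolding B_def by (intro suminf_cong) simp
  also have "\<dots> = (\<integral>\<^sup>+y. (\<Sum>j. h (real N / (y + real (N + j))) * ennreal (real N / (y + real (N + j))\<^sup>2) *
      indicator {0..1} y) \<partial>lborel)"
    by (intro nn_integral_suminf[symmetric]) measurable
  finally show ?thesis by simp
qed

text \<open>\<open>\<rho> N k\<close> is a fixed point of the transfer operator: with
  \<open>z = y + N + j\<close> the terms are \<open>k / (z * (z + 1)) = k / z - k / (z + 1)\<close>.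
  As the digits start at \<open>N\<close>, the first term left by telescoping is
  \<open>k / (y + N)\<close>.\<close>

lemma \<rho>_transfer:
  assumes "N \<ge> 1" "0 \<le> y" "0 \<le> k"
  shows "(\<Sum>j. ennreal (\<rho> N k (real N / (y + real (N + j)))) * ennreal (real N / (y + real (N + j))\<^sup>2)) =
    ennreal (\<rho> N k y)"
proof -
  define f where "f j = k / (y + real N + real j)" for j
  have "f \<longlonglongrightarrow> 0" unfolding f_def
    by (intro tendsto_divide_0[OF tendsto_const] filterlim_at_top_imp_at_infinity
        filterlim_tendsto_add_at_top[OF tendsto_const] filterlim_real_sequentially)
  then have sums: "(\<lambda>j. f j - f (Suc j)) sums \<rho> N k y"
    using telescope_sums'[of f 0] by (simp add: f_def \<rho>_def)
  have eq: "\<rho> N k (real N / (y + real (N + j))) * (real N / (y + real (N + j))\<^sup>2) = f j - f (Suc j)" for j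
  proof -
    define z where "z = y + real N + real j"
    have z: "z > 0" "real N > 0" using assms by (auto simp: z_def)
    have "\<rho> N k (real N / z) = k * z / (real N * (z + 1))"
      using z by (simp add: \<rho>_def field_simps)
    then have "\<rho> N k (real N / z) * (real N / z\<^sup>2) = k / (z * (z + 1))"
      using z by (simp add: power2_eq_square)
    also have "\<dots> = k / z - k / (z + 1)" using z by (simp add: field_simps)
    finally show ?thesis by (simp add: z_def f_def add_ac)
  qed
  have nonneg: "0 \<le> \<rho> N k (real N / (y + real (N + j)))" for j using assms by (simp add: \<rho>_def)
  have diff_nonneg: "0 \<le> f j - f (Suc j)" for j unfolding eq[symmetric] using nonneg[of j] by simp
  have "ennreal (\<rho> N k (real N / (y + real (N + j)))) * ennreal (real N / (y + real (N + j))\<^sup>2) =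
      ennreal (f j - f (Suc j))" for j
    unfolding eq[symmetric] using nonneg[of j] by (subst ennreal_mult) simp_all
  then show ?thesis by (simp only: suminf_ennreal_eq[OF diff_nonneg sums])
qed

text \<open>For \<open>0 \<le> y < 1\<close> the indicator of \<open>A\<close> after
  \<open>T\<close> equals \<open>indicator A y\<close> on every branch over \<open>y\<close>, so it
  leaves the sum and the fixed-point equation applies.\<close>

lemma G_invariant:
  assumes "N \<ge> 1" "0 \<le> k"
  shows "invariant_measure N (G N k)"
  unfolding invariant_measure_def
proof (intro conjI ballI)
  show "sets (G N k) = sets (restrict_space borel {0..1})"
    by (simp add: G_def sets_lebesgue_I)
  fix A assume "A \<in> sets (restrict_space borel {0..1::real})"
  then have A [measurable]: "A \<in> sets borel" and sub: "A \<subseteq> {0..1}"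
    by (simp_all add: sets_restrict_space_iff)
  have TA: "T N -` A \<in> sets borel" using measurable_sets[OF T_measurable_borel A, of N] by simp
  define h where "h x = ennreal (\<rho> N k x) * indicator A (T N x)" for x
  have [measurable]: "h \<in> borel_measurable borel" unfolding h_def by measurable
  have "emeasure (G N k) (T N -` A \<inter> {0..1}) = (\<integral>\<^sup>+x. h x * indicator {0..1} x \<partial>lborel)"
    using TA by (subst emeasure_G)
      (auto intro!: nn_integral_cong simp: h_def split: split_indicator)
  also have "\<dots> = (\<integral>\<^sup>+y. (\<Sum>j. h (real N / (y + real (N + j))) * ennreal (real N / (y + real (N + j))\<^sup>2)) *
      indicator {0..1} y \<partial>lborel)"
    using assms by (intro nn_integral_sum_branches) auto
  also have "\<dots> = (\<integral>\<^sup>+y. ennreal (\<rho> N k y) * indicator A y \<partial>lborel)"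
  proof (intro nn_integral_cong_AE)
    show "AE y in lborel. (\<Sum>j. h (real N / (y + real (N + j))) * ennreal (real N / (y + real (N + j))\<^sup>2)) *
      indicator {0..1} y = ennreal (\<rho> N k y) * indicator A y"
      using AE_lborel_singleton[of 1]
    proof eventually_elim
      case (elim y)
      show ?case
      proof (cases "y \<in> {0..1}")
        case True
        then have y: "0 \<le> y" "y < 1" using elim by auto
        have "T N (real N / (y + real (N + j))) = y" for j
          using T_branch[OF y, of "int (N + j)" N] assms by simp
        then have "(\<Sum>j. h (real N / (y + real (N + j))) * ennreal (real N / (y + real (N + j))\<^sup>2)) =
            (\<Sum>j. indicator A y * (ennreal (\<rho> N k (real N / (y + real (N + j)))) *
              ennreal (real N / (y + real (N + j))\<^sup>2)))"
          by (simp only: h_def ac_simps)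
        also have "\<dots> = indicator A y * ennreal (\<rho> N k y)"
          by (simp only: ennreal_suminf_cmult \<rho>_transfer[OF assms(1) y(1) assms(2)])
        finally show ?thesis using True by (simp add: mult.commute)
      next
        case False
        then show ?thesis using sub by (auto simp: indicator_def)
      qed
    qed
  qed
  also have "\<dots> = emeasure (G N k) A" using sub by (simp add: emeasure_G)
  finally show "emeasure (G N k) (T N -` A \<inter> {0..1}) = emeasure (G N k) A" .
qed

section \<open>Uniqueness\<close>

text \<open>The difference \<open>g - f\<close> has integral 0; finiteness permits subtracting the
  integrals in \<open>ennreal\<close>.\<close>

lemma AE_eq_of_nn_integral_eq:
  assumes [measurable]: "f \<in> borel_measurable M" "g \<in> borel_measurable M"
    and le: "AE x in M. f x \<le> g x"
    and eq: "integral\<^sup>N M f = integral\<^sup>N M g" and fin: "integral\<^sup>N M f \<noteq> \<infinity>"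
  shows "AE x in M. f x = (g x :: ennreal)"
proof -
  have "(\<integral>\<^sup>+x. g x - f x \<partial>M) = 0"
    using fin by (subst nn_integral_diff[OF _ _ fin le]) (auto simp: eq)
  then have "AE x in M. g x - f x = 0" by (subst (asm) nn_integral_0_iff_AE) auto
  with le show ?thesis
    by eventually_elim (auto simp: diff_eq_0_iff_ennreal intro: antisym)
qed

text \<open>Both differences arise by removing \<open>A \<inter> B\<close>, of finite measure, from
  sets of equal measure.\<close>

lemma (in finite_measure) emeasure_Diff_eq_of_emeasure_eq:
  assumes "A \<in> sets M" "B \<in> sets M" "emeasure M A = emeasure M B"
  shows "emeasure M (A - B) = emeasure M (B - A)"
  using assms finite_measure_Diff'[of A B] finite_measure_Diff'[of B A]
  by (simp add: emeasure_eq_measure Int_commute)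

text \<open>For invariant densities \<open>f\<close> and \<open>r\<close>, the set \<open>{r < f}\<close> is almost invariant: it loses and gains the
  same mass under \<open>T\<close> for each of the two measures, but the measure of \<open>f\<close> charges the lost part more
  and the gained part less.\<close>

lemma invariant_prob_density_unique:
  assumes "N \<ge> 1" and f: "invariant_prob_density N f" and r: "invariant_prob_density N r"
    and pos: "\<And>x. x \<in> {0..1} \<Longrightarrow> 0 < r x"
  shows "AE x in lebesgue_I. f x = r x"
proof -
  define \<nu> \<mu> where "\<nu> = density lebesgue_I (\<lambda>x. ennreal (f x))"
    and "\<mu> = density lebesgue_I (\<lambda>x. ennreal (r x))"
  have [measurable]: "f \<in> borel_measurable lebesgue_I" "r \<in> borel_measurable lebesgue_I"
    and f0: "\<And>x. x \<in> {0..1} \<Longrightarrow> 0 \<le> f x"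
    using f r by (auto simp: invariant_prob_density_def)
  interpret \<nu>: prob_space \<nu> using f by (simp add: \<nu>_def invariant_prob_density_def)
  interpret \<mu>: prob_space \<mu> using r by (simp add: \<mu>_def invariant_prob_density_def)
  have [simp]: "sets \<nu> = sets lebesgue_I" "sets \<mu> = sets lebesgue_I"
    by (simp_all add: \<nu>_def \<mu>_def)
  have \<nu>: "emeasure \<nu> A = (\<integral>\<^sup>+x. ennreal (f x) * indicator A x \<partial>lebesgue_I)"
    and \<mu>: "emeasure \<mu> A = (\<integral>\<^sup>+x. ennreal (r x) * indicator A x \<partial>lebesgue_I)"
    if "A \<in> sets lebesgue_I" for A
    using that by (simp_all add: \<nu>_def \<mu>_def emeasure_density)
  define E where "E = {x\<in>space lebesgue_I. r x < f x}"
  have E [measurable]: "E \<in> sets lebesgue_I" unfolding E_def by measurable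
  have E_borel: "E \<in> sets borel" and E_sub: "E \<subseteq> {0..1}" using E by (simp_all add: sets_lebesgue_I_iff)
  define E' where "E' = T N -` E \<inter> {0..1}"
  have E' [measurable]: "E' \<in> sets lebesgue_I"
    using measurable_sets[OF T_measurable E, of N] by (simp add: E'_def space_lebesgue_I)
  have "emeasure \<nu> E = emeasure \<nu> E'" "emeasure \<mu> E = emeasure \<mu> E'"
    using f r E unfolding invariant_prob_density_def invariant_measure_def E'_def \<nu>_def \<mu>_def
    by (auto simp: sets_lebesgue_I)
  then have \<nu>D: "emeasure \<nu> (E - E') = emeasure \<nu> (E' - E)" and \<mu>D: "emeasure \<mu> (E - E') = emeasure \<mu> (E' - E)"
    by (auto intro!: \<nu>.emeasure_Diff_eq_of_emeasure_eq \<mu>.emeasure_Diff_eq_of_emeasure_eq)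
  \<comment> \<open>As \<open>r < f\<close> on \<open>E\<close> and \<open>f \<le> r\<close> off it,
    the measures of the two differences form a closed chain: \<open>\<mu> (E - E') \<le> \<nu> (E -
    E') = \<nu> (E' - E) \<le> \<mu> (E' - E) = \<mu> (E - E')\<close>.\<close>
  have "emeasure \<mu> (E - E') \<le> emeasure \<nu> (E - E')"
    unfolding \<mu>[OF sets.Diff[OF E E']] \<nu>[OF sets.Diff[OF E E']]
    by (intro nn_integral_mono) (auto simp: E_def intro!: ennreal_leI split: split_indicator)
  moreover have "emeasure \<nu> (E' - E) \<le> emeasure \<mu> (E' - E)"
    unfolding \<mu>[OF sets.Diff[OF E' E]] \<nu>[OF sets.Diff[OF E' E]]
    by (intro nn_integral_mono) (auto simp: E_def intro!: ennreal_leI split: split_indicator)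
  ultimately have eq: "emeasure \<mu> (E - E') = emeasure \<nu> (E - E')"
    using \<nu>D \<mu>D by simp
  have "AE x in lebesgue_I. ennreal (r x) * indicator (E - E') x = ennreal (f x) * indicator (E - E') x"
  proof (rule AE_eq_of_nn_integral_eq)
    show "AE x in lebesgue_I. ennreal (r x) * indicator (E - E') x \<le> ennreal (f x) * indicator (E - E') x"
      by (intro AE_I2) (auto simp: E_def intro!: ennreal_leI split: split_indicator)
    show "(\<integral>\<^sup>+x. ennreal (r x) * indicator (E - E') x \<partial>lebesgue_I) =
        (\<integral>\<^sup>+x. ennreal (f x) * indicator (E - E') x \<partial>lebesgue_I)"
      using eq by (simp add: \<mu> \<nu>)
    show "(\<integral>\<^sup>+x. ennreal (r x) * indicator (E - E') x \<partial>lebesgue_I) \<noteq> \<infinity>"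
      using \<mu>.emeasure_finite[of "E - E'"] by (simp add: \<mu>)
  qed measurable
  \<comment> \<open>The strict inequality \<open>r < f\<close> on \<open>E\<close> leaves only a
    null set where both densities agree.\<close>
  then have D1: "AE x in lebesgue_I. x \<notin> E - E'"
  proof (rule AE_mp, intro AE_I2 impI notI)
    fix x assume x: "x \<in> space lebesgue_I" "x \<in> E - E'"
      "ennreal (r x) * indicator (E - E') x = ennreal (f x) * indicator (E - E') x"
    then show False
      using pos[of x] f0[of x] by (auto simp: E_def space_lebesgue_I)
  qed
  \<comment> \<open>Both differences have equal \<open>\<mu>\<close> measure, so
    \<open>E' - E\<close> is \<open>\<mu>\<close>-null too, and \<open>r > 0\<close> makes it
    Lebesgue null.\<close>
  then have "emeasure \<mu> (E - E') = 0"
    unfolding \<mu>[OF sets.Diff[OF E E']]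
    by (subst nn_integral_0_iff_AE) (auto elim!: eventually_mono)
  then have "(\<integral>\<^sup>+x. ennreal (r x) * indicator (E' - E) x \<partial>lebesgue_I) = 0"
    using \<mu>D by (simp add: \<mu>)
  then have "AE x in lebesgue_I. ennreal (r x) * indicator (E' - E) x = 0"
    by (subst (asm) nn_integral_0_iff_AE) auto
  then have D2: "AE x in lebesgue_I. x \<notin> E' - E"
  proof (rule AE_mp, intro AE_I2 impI notI)
    fix x assume "x \<in> space lebesgue_I" "x \<in> E' - E" "ennreal (r x) * indicator (E' - E) x = 0"
    then show False using pos[of x] by (auto simp: space_lebesgue_I)
  qed
  have "AE x in lborel. x \<in> {0..1} \<longrightarrow> (x \<in> E \<longleftrightarrow> T N x \<in> E)"
    using D1 D2 unfolding AE_lebesgue_I_iff by eventually_elim (auto simp: E'_def)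
  then have cases: "emeasure lborel (E \<inter> {0..1}) = 0 \<or> emeasure lborel ({0..1} - E) = 0"
    using T_ergodic[OF assms(1) E_borel] by blast
  have total: "(\<integral>\<^sup>+x. ennreal (f x) \<partial>lebesgue_I) = 1" "(\<integral>\<^sup>+x. ennreal (r x) \<partial>lebesgue_I) = 1"
    using \<nu>.emeasure_space_1 \<mu>.emeasure_space_1
    by (simp_all add: \<nu>_def \<mu>_def emeasure_density cong: nn_integral_cong)
  \<comment> \<open>In either case the densities are ordered almost everywhere, and both have
    integral 1.\<close>
  from cases have "AE x in lebesgue_I. ennreal (f x) = ennreal (r x)"
  proof
    assume "emeasure lborel (E \<inter> {0..1}) = 0"
    then have "AE x in lborel. x \<notin> E"
      using E_borel E_sub by (intro AE_not_in null_setsI) (auto simp: Int_absorb2)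
    then have "AE x in lebesgue_I. ennreal (f x) \<le> ennreal (r x)"
      unfolding AE_lebesgue_I_iff
      by eventually_elim (auto simp: E_def space_lebesgue_I intro!: ennreal_leI)
    then show ?thesis by (intro AE_eq_of_nn_integral_eq) (simp_all add: total)
  next
    assume "emeasure lborel ({0..1} - E) = 0"
    then have "AE x in lborel. x \<notin> {0..1} - E"
      using E_borel by (intro AE_not_in null_setsI) auto
    then have "AE x in lebesgue_I. ennreal (r x) \<le> ennreal (f x)"
      unfolding AE_lebesgue_I_iff
      by eventually_elim (auto simp: E_def space_lebesgue_I intro!: ennreal_leI)
    then have "AE x in lebesgue_I. ennreal (r x) = ennreal (f x)"
      by (intro AE_eq_of_nn_integral_eq) (simp_all add: total)
    then show ?thesis by eventually_elim simp
  qed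
  \<comment> \<open>Nonnegativity of both densities makes \<open>ennreal\<close> injective on their
    values.\<close>
  then show ?thesis
  proof (rule AE_mp, intro AE_I2 impI)
    fix x assume "x \<in> space lebesgue_I" "ennreal (f x) = ennreal (r x)"
    then show "f x = r x" using pos[of x] f0[of x] by (simp add: space_lebesgue_I)
  qed
qed

text \<open>The definite articles become \<open>\<exists>!k\<close> over all reals and, for the
  density, uniqueness up to null sets, since a change on a null set alters no measure.\<close>

theorem proposition2p9:
  fixes N :: nat
  assumes "N \<ge> 1"
  shows "(\<exists>!k. prob_space (G N k)) \<and>
    (\<forall>k. prob_space (G N k) \<longrightarrow>
       invariant_prob_density N (\<rho> N k) \<and>
       (\<forall>f. invariant_prob_density N f \<longrightarrow> (AE x in lebesgue_I. f x = \<rho> N k x)) \<and>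
       k = inverse (ln ((real N + 1) / real N)))"
proof (intro conjI allI impI)
  show "\<exists>!k. prob_space (G N k)" using prob_space_G_iff[OF assms] by simp
next
  fix k assume k: "prob_space (G N k)"
  show k_eq: "k = inverse (ln ((real N + 1) / real N))" using k prob_space_G_iff[OF assms] by simp
  have "k > 0" using assms unfolding k_eq by simp
  then have pos: "0 < \<rho> N k x" if "x \<in> {0..1}" for x
    using assms that by (simp add: \<rho>_def add_nonneg_pos)
  show inv: "invariant_prob_density N (\<rho> N k)"
    unfolding invariant_prob_density_def G_def[symmetric]
    using k G_invariant[OF assms] \<open>k > 0\<close> pos by (auto intro: less_imp_le)
  show "AE x in lebesgue_I. f x = \<rho> N k x" if "invariant_prob_density N f" for f
    using invariant_prob_density_unique[OF assms that inv pos] .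
qed

end
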